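(* Let $\ell\ge 1$ be a fixed integer. Then, as $k\to\infty$ through the positive integers, $$\binom{k}{\lfloor k\ell/2\rfloor}_{\ell+1}\;\sim\;\frac{(\ell+1)^k}{\sqrt{2\pi k\,\frac{(\ell+1)^2-1}{12}}},$$ that is, the ratio of the left-hand side to the right-hand side tends to $1$ as $k\to\infty$.
   Context: For integers $\ell\ge 0$, $k\ge 0$ and $0\le n\le k\ell$, the extended binomial coefficient $\binom{k}{n}_{\ell+1}$ is defined as the coefficient of $x^n$ in the polynomial $(1+x+x^2+\cdots+x^\ell)^k$, i.e. $$(1+x+x^2+\cdots+x^\ell)^k=\sum_{n=0}^{k\ell}\binom{k}{n}_{\ell+1}x^n.$$ For sequences $a_k,b_k$, the notation $a_k\sim b_k$ means $\lim_{k\to\infty} a_k/b_k=1$. $\lfloor x\rfloor$ denotes the largest integer less than or equal to $x$. *)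

theory Defs
  imports Complex_Main "HOL-Computational_Algebra.Polynomial"
begin

(* The first argument is the subscript of the usual notation: for q = l + 1 the base
   polynomial is 1 + x + ... + x^l.  For n > k * l the value is 0. *)
definition ext_binomial :: "nat \<Rightarrow> nat \<Rightarrow> nat \<Rightarrow> nat" where
  "ext_binomial q k n = coeff ((\<Sum>i<q. monom (1::nat) i) ^ k) n"

end

theory Submission
  imports Defs "HOL-Probability.Distributions" "HOL-Real_Asymp.Real_Asymp"
begin

text \<open>
  The proof is Fourier inversion followed by Laplace's method, that is, a local limit theorem for a
  sum of \<open>k\<close> independent variables uniform on \<open>{0..l}\<close>.  Put \<open>z = exp (i t)\<close> in
  \<open>(1 + z + \<dots> + z^l)^k\<close> and pull out the phase \<open>exp (i k l t / 2)\<close>: what remains is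
  \<open>(l + 1)^k \<phi>(t)^k\<close>, where \<open>\<phi>\<close> is the characteristic function of the uniform distribution on
  \<open>{0..l}\<close> shifted to mean 0, which is real by symmetry.  Orthogonality of the characters on
  \<open>[-\<pi>, \<pi>]\<close> then gives (\<open>ext_binomial_integral\<close>)
  \<open>2 \<pi> c\<^sub>n = (l + 1)^k \<integral> \<phi>(t)^k cos ((k l / 2 - n) t) dt\<close>
  for the coefficient \<open>c\<^sub>n\<close> of \<open>z^n\<close>.

  Substitute \<open>t = s / sqrt k\<close>.  With \<open>v = ((l + 1)^2 - 1) / 12\<close> the variance,
  \<open>\<phi>(s / sqrt k)^k\<close> tends to \<open>exp (- v s^2 / 2)\<close> (\<open>uniform_char_power_tendsto\<close>); the cosine tends
  to 1, because \<open>k l / 2 - n\<close> stays bounded for the central \<open>n\<close>; and the bound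
  \<open>\<bar>\<phi>(t)\<bar> \<le> exp (- t^2 / (16 (l + 1)))\<close> on \<open>[-\<pi>, \<pi>]\<close> (\<open>abs_uniform_char_le\<close>) supplies an
  integrable Gaussian majorant.  Dominated convergence yields the limit
  \<open>\<integral> exp (- v s^2 / 2) ds = sqrt (2 \<pi> / v)\<close>, and the constants cancel.
\<close>

section \<open>The generating function\<close>

lemma coeff_of_nat_power:
  fixes p :: "nat poly" and p' :: "'a::comm_semiring_1 poly"
  assumes "\<And>n. coeff p' n = of_nat (coeff p n)"
  shows "coeff (p' ^ k) n = of_nat (coeff (p ^ k) n)"
proof (induction k arbitrary: n)
  case (Suc k)
  then show ?case by (simp add: coeff_mult assms)
qed simp

lemma ext_binomial_generating_function:
  fixes z :: "'a::comm_ring_1"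
  shows "(\<Sum>i<Suc l. z ^ i) ^ k = (\<Sum>n\<le>k * l. of_nat (ext_binomial (Suc l) k n) * z ^ n)"
proof -
  define p :: "'a poly" where "p = (\<Sum>i<Suc l. monom 1 i)"
  have c: "coeff (p ^ k) n = of_nat (ext_binomial (Suc l) k n)" for n
    unfolding ext_binomial_def
    by (rule coeff_of_nat_power) (simp add: p_def coeff_sum of_nat_sum if_distrib)
  have "degree p \<le> l"
    unfolding p_def by (intro degree_sum_le) (auto intro: order.trans[OF degree_monom_le])
  then have deg: "degree (p ^ k) \<le> k * l"
    by (metis degree_power_le le_trans mult.commute mult_le_mono1)
  have "(\<Sum>i<Suc l. z ^ i) ^ k = poly (p ^ k) z"
    by (simp add: p_def poly_power poly_sum poly_monom del: sum.lessThan_Suc)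
  also have "\<dots> = (\<Sum>n\<le>degree (p ^ k). coeff (p ^ k) n * z ^ n)"
    by (rule poly_altdef)
  also have "\<dots> = (\<Sum>n\<le>k * l. coeff (p ^ k) n * z ^ n)"
    using deg by (intro sum.mono_neutral_left) (auto simp: coeff_eq_0)
  finally show ?thesis by (simp add: c)
qed

section \<open>The Fourier integral for the coefficients\<close>

text \<open>
  The characteristic function of the uniform distribution on \<open>{0..l}\<close> shifted by its mean
  \<open>l / 2\<close>.  The distribution is symmetric, so only the cosines are needed and the values are real.
\<close>

definition uniform_char :: "nat \<Rightarrow> real \<Rightarrow> real" where
  "uniform_char l t = (\<Sum>j\<le>l. cos ((real j - real l / 2) * t)) / (real l + 1)"

lemma borel_measurable_uniform_char [measurable]: "uniform_char l \<in> borel_measurable borel"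
  unfolding uniform_char_def by measurable

lemma sum_cis_eq_uniform_char:
  "(\<Sum>i<Suc l. cis t ^ i) = cis (real l * t / 2) * of_real ((real l + 1) * uniform_char l t)"
proof -
  \<comment> \<open>the reflection \<open>j \<mapsto> l - j\<close> kills the imaginary part\<close>
  have sin0: "(\<Sum>j\<le>l. sin ((real j - real l / 2) * t)) = 0"
  proof -
    have "(\<Sum>j\<le>l. sin ((real j - real l / 2) * t)) = (\<Sum>j\<le>l. sin ((real (l - j) - real l / 2) * t))"
      by (rule sum.nat_diff_reindex[of _ "Suc l", unfolded lessThan_Suc_atMost, symmetric, simplified])
    also have "\<dots> = (\<Sum>j\<le>l. - sin ((real j - real l / 2) * t))"
    proof (intro sum.cong refl)
      fix j assume "j \<in> {..l}"
      then have "(real (l - j) - real l / 2) * t = - ((real j - real l / 2) * t)"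
        by (simp add: of_nat_diff algebra_simps)
      then show "sin ((real (l - j) - real l / 2) * t) = - sin ((real j - real l / 2) * t)"
        by (metis sin_minus)
    qed
    finally show ?thesis by (simp add: sum_negf)
  qed
  have "(\<Sum>i<Suc l. cis t ^ i) = cis (real l * t / 2) * (\<Sum>j\<le>l. cis ((real j - real l / 2) * t))"
    by (simp add: sum_distrib_left cis_mult Complex.DeMoivre lessThan_Suc_atMost algebra_simps
        del: sum.lessThan_Suc)
  also have "(\<Sum>j\<le>l. cis ((real j - real l / 2) * t)) = of_real ((real l + 1) * uniform_char l t)"
    by (rule complex_eqI) (simp_all add: sin0 uniform_char_def)
  finally show ?thesis .
qed

text \<open>
  The real part of the generating function at \<open>cis t\<close>, multiplied by \<open>cis (- n t)\<close>.
\<close>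

lemma ext_binomial_cos_sum:
  "(\<Sum>m\<le>k * l. real (ext_binomial (Suc l) k m) * cos ((real m - real n) * t))
     = ((real l + 1) * uniform_char l t) ^ k * cos ((real (k * l) / 2 - real n) * t)"
proof -
  have "(\<Sum>m\<le>k * l. of_nat (ext_binomial (Suc l) k m) * cis ((real m - real n) * t))
      = cis (- real n * t) * (\<Sum>m\<le>k * l. of_nat (ext_binomial (Suc l) k m) * cis t ^ m)"
    by (simp add: sum_distrib_left mult.left_commute[of "cis _"] cis_mult Complex.DeMoivre left_diff_distrib)
  also have "\<dots> = cis (- real n * t) * (\<Sum>i<Suc l. cis t ^ i) ^ k"
    by (simp only: ext_binomial_generating_function)
  also have "\<dots> = of_real (((real l + 1) * uniform_char l t) ^ k) * cis ((real (k * l) / 2 - real n) * t)"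
  proof -
    define a where "a = (real l + 1) * uniform_char l t"
    have "cis (- real n * t) * cis (real k * (real l * t / 2)) = cis ((real (k * l) / 2 - real n) * t)"
      unfolding cis_mult by (simp add: algebra_simps)
    then have "cis (- real n * t) * (cis (real l * t / 2) * of_real a) ^ k
        = of_real (a ^ k) * cis ((real (k * l) / 2 - real n) * t)"
      unfolding power_mult_distrib Complex.DeMoivre of_real_power
      by (metis mult.assoc mult.commute)
    then show ?thesis
      unfolding sum_cis_eq_uniform_char a_def .
  qed
  finally have "Re (\<Sum>m\<le>k * l. of_nat (ext_binomial (Suc l) k m) * cis ((real m - real n) * t))
     = Re (of_real (((real l + 1) * uniform_char l t) ^ k) * cis ((real (k * l) / 2 - real n) * t))"
    by (rule arg_cong)
  then show ?thesis by (simp add: Re_complex_of_real flip: of_real_power)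
qed

lemma integral_cos_period:
  fixes a :: int
  shows "has_bochner_integral lborel (\<lambda>t. cos (of_int a * t) * indicator {-pi..pi} t)
           (if a = 0 then 2 * pi else 0)"
proof (cases "a = 0")
  case True
  have "has_bochner_integral lborel (\<lambda>t. 1 * indicator {-pi..pi} t) (pi - (-pi))"
    by (rule has_bochner_integral_FTC_Icc_real) (auto intro!: derivative_eq_intros)
  with True show ?thesis by simp
next
  case False
  have "has_bochner_integral lborel (\<lambda>t. cos (of_int a * t) * indicator {-pi..pi} t)
      (sin (of_int a * pi) / of_int a - sin (of_int a * (-pi)) / of_int a)"
    using False
    by (intro has_bochner_integral_FTC_Icc_real) (auto intro!: derivative_eq_intros)
  then show ?thesis using False by (simp add: sin_int_times_real mult.commute)
qed

lemma ext_binomial_integral: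
  assumes "n \<le> k * l"
  shows "2 * pi * real (ext_binomial (Suc l) k n) = (real l + 1) ^ k *
     (\<integral>t. uniform_char l t ^ k * cos ((real (k * l) / 2 - real n) * t) * indicator {-pi..pi} t \<partial>lborel)"
proof -
  have "has_bochner_integral lborel
     (\<lambda>t. \<Sum>m\<le>k * l. real (ext_binomial (Suc l) k m) *
            (cos (of_int (int m - int n) * t) * indicator {-pi..pi} t))
     (\<Sum>m\<le>k * l. real (ext_binomial (Suc l) k m) * (if int m - int n = 0 then 2 * pi else 0))"
    by (intro has_bochner_integral_sum has_bochner_integral_mult_right integral_cos_period)
  also have "(\<lambda>t. \<Sum>m\<le>k * l. real (ext_binomial (Suc l) k m) *
            (cos (of_int (int m - int n) * t) * indicator {-pi..pi} t))
      = (\<lambda>t. (\<Sum>m\<le>k * l. real (ext_binomial (Suc l) k m) * cos ((real m - real n) * t)) * indicator {-pi..pi} t)"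
    by (simp add: sum_distrib_right mult.assoc)
  also have "\<dots> = (\<lambda>t. (real l + 1) ^ k * (uniform_char l t ^ k * cos ((real (k * l) / 2 - real n) * t) * indicator {-pi..pi} t))"
    unfolding ext_binomial_cos_sum by (simp add: power_mult_distrib mult_ac)
  also have "(\<Sum>m\<le>k * l. real (ext_binomial (Suc l) k m) * (if int m - int n = 0 then 2 * pi else 0))
     = (\<Sum>m\<le>k * l. if m = n then 2 * pi * real (ext_binomial (Suc l) k m) else 0)"
    by (intro sum.cong) auto
  also have "\<dots> = 2 * pi * real (ext_binomial (Suc l) k n)"
    using assms by simp
  finally show ?thesis
    by (auto dest!: has_bochner_integral_integral_eq)
qed

section \<open>A Gaussian bound for the characteristic function\<close>

lemma abs_sin_ge_half:
  fixes x :: real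
  assumes "\<bar>x\<bar> \<le> 1"
  shows "\<bar>x\<bar> / 2 \<le> \<bar>sin x\<bar>"
proof -
  have "\<bar>sin x - x\<bar> \<le> \<bar>x\<bar> ^ 3 / 6"
  proof -
    have "(\<Sum>m<3. sin_coeff m * x ^ m) = x"
      by (simp add: lessThan_nat_numeral sin_coeff_def)
    moreover have "inverse (fact 3) * \<bar>x\<bar> ^ 3 = \<bar>x\<bar> ^ 3 / 6"
      by (simp add: fact_numeral)
    ultimately show ?thesis
      using Maclaurin_sin_bound[of x 3] by metis
  qed
  moreover have "\<bar>x\<bar> ^ 3 \<le> \<bar>x\<bar>"
    using power_decreasing[of 1 3 "\<bar>x\<bar>"] assms by simp
  ultimately show ?thesis by linarith
qed

text \<open>
  The terms 0 and 1 of \<open>1 + z + \<dots> + z^l\<close> alone give enough cancellation: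
  \<open>\<bar>1 + cis t\<bar> = 2 cos (t / 2)\<close> falls quadratically short of 2, and the other \<open>l - 1\<close> terms have
  modulus 1.  The bound fails for \<open>l = 0\<close>, where \<open>uniform_char\<close> is constantly 1, and for large
  \<open>t\<close>, since \<open>uniform_char\<close> is periodic up to sign.
\<close>

lemma abs_uniform_char_le:
  assumes "l \<ge> 1" and "\<bar>t\<bar> \<le> pi"
  shows "\<bar>uniform_char l t\<bar> \<le> exp (- (t\<^sup>2 / (16 * (real l + 1))))"
proof -
  have "(real l + 1) * \<bar>uniform_char l t\<bar> = cmod (\<Sum>i<Suc l. cis t ^ i)"
    unfolding sum_cis_eq_uniform_char norm_mult norm_of_real by (simp add: abs_mult)
  also have "(\<Sum>i<Suc l. cis t ^ i) = (1 + cis t) + (\<Sum>i\<in>{2..<Suc l}. cis t ^ i)"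
  proof -
    have "{..<Suc l} = {0, 1} \<union> {2..<Suc l}" using assms(1) by auto
    then show ?thesis by (simp only:) (subst sum.union_disjoint, auto)
  qed
  also have "cmod \<dots> \<le> cmod (1 + cis t) + (real l - 1)"
  proof (rule norm_triangle_mono[OF order.refl])
    have "cmod (\<Sum>i\<in>{2..<Suc l}. cis t ^ i) \<le> real (card {2..<Suc l}) * 1"
      by (rule sum_norm_bound) (simp add: norm_power)
    then show "cmod (\<Sum>i\<in>{2..<Suc l}. cis t ^ i) \<le> real l - 1"
      using assms(1) by simp
  qed
  also have "cmod (1 + cis t) = 2 * \<bar>cos (t / 2)\<bar>"
  proof -
    have "1 + cis t = cis (t / 2) * of_real (2 * cos (t / 2))"
      using cos_double_cos[of "t / 2"] sin_double[of "t / 2"]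
      by (auto simp: complex_eq_iff power2_eq_square)
    then show ?thesis by (simp add: norm_mult)
  qed
  also have "\<bar>cos (t / 2)\<bar> = cos (t / 2)"
    using assms(2) by (intro abs_of_nonneg cos_ge_zero) auto
  also have "\<dots> = 1 - 2 * (sin (t / 4))\<^sup>2"
    using cos_double_sin[of "t / 4"] by simp
  also have "(sin (t / 4))\<^sup>2 \<ge> t\<^sup>2 / 64"
  proof -
    have "\<bar>t / 4\<bar> / 2 \<le> \<bar>sin (t / 4)\<bar>"
      using assms(2) pi_less_4 by (intro abs_sin_ge_half) auto
    then have "(\<bar>t / 4\<bar> / 2)\<^sup>2 \<le> \<bar>sin (t / 4)\<bar>\<^sup>2"
      by (rule power_mono) simp
    then show ?thesis by (simp add: power_divide)
  qed
  then have "2 * (1 - 2 * (sin (t / 4))\<^sup>2) + (real l - 1) \<le> (real l + 1) * (1 - t\<^sup>2 / (16 * (real l + 1)))"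
  proof -
    have "(real l + 1) * (1 - t\<^sup>2 / (16 * (real l + 1))) = real l + 1 - t\<^sup>2 / 16"
      by (simp add: divide_simps) (simp add: algebra_simps)
    then show ?thesis using \<open>(sin (t / 4))\<^sup>2 \<ge> t\<^sup>2 / 64\<close> by simp
  qed
  finally have "\<bar>uniform_char l t\<bar> \<le> 1 + - (t\<^sup>2 / (16 * (real l + 1)))"
    by (simp add: mult_le_cancel_left_pos del: of_nat_Suc)
  also have "\<dots> \<le> exp (- (t\<^sup>2 / (16 * (real l + 1))))"
    by (rule exp_ge_add_one_self)
  finally show ?thesis .
qed

section \<open>The pointwise Gaussian limit\<close>

text \<open>\<open>l + 1\<close> times the variance of the uniform distribution on \<open>{0..l}\<close>.\<close>

lemma sum_centred_squares:
  "(\<Sum>j\<le>l. (real j - real l / 2)\<^sup>2) = (real l + 1) * (((real l + 1)\<^sup>2 - 1) / 12)"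
proof -
  have s1: "(\<Sum>j\<le>l. real j) = real l * (real l + 1) / 2"
    by (induction l) (auto simp: field_simps)
  have s2: "(\<Sum>j\<le>l. (real j)\<^sup>2) = real l * (real l + 1) * (2 * real l + 1) / 6"
    by (induction l) (auto simp: field_simps power2_eq_square)
  have "(\<Sum>j\<le>l. (real j - real l / 2)\<^sup>2)
     = (\<Sum>j\<le>l. (real j)\<^sup>2) - real l * (\<Sum>j\<le>l. real j) + (real l + 1) * (real l / 2)\<^sup>2"
    by (simp add: power2_diff sum.distrib sum_subtractf sum_distrib_left mult_ac)
  then show ?thesis unfolding s1 s2 by (simp add: field_simps power2_eq_square)
qed

text \<open>
  If both bases lie in the unit ball, their \<open>k\<close>-th powers differ by at most \<open>k\<close> times the difference
  of the bases, so \<open>x k\<close> may be replaced by its limit.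
\<close>

lemma power_one_plus_tendsto_exp:
  fixes x :: "nat \<Rightarrow> real"
  assumes lim: "x \<longlonglongrightarrow> a" and le1: "\<And>k. \<bar>1 + x k / real k\<bar> \<le> 1" and "a \<le> 0"
  shows "(\<lambda>k. (1 + x k / real k) ^ k) \<longlonglongrightarrow> exp a"
proof (rule Lim_transform[OF tendsto_exp_limit_sequentially[of a]])
  have "(\<lambda>k. \<bar>x k - a\<bar>) \<longlonglongrightarrow> 0"
    using lim by (simp add: LIM_zero_iff tendsto_rabs_zero_iff)
  then show "(\<lambda>k. (1 + x k / real k) ^ k - (1 + a / real k) ^ k) \<longlonglongrightarrow> 0"
  proof (rule Lim_null_comparison[rotated])
    have "eventually (\<lambda>k. real k > - a) sequentially"
      using filterlim_real_sequentially unfolding filterlim_at_top_dense by blast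
    then show "eventually (\<lambda>k. norm ((1 + x k / real k) ^ k - (1 + a / real k) ^ k) \<le> \<bar>x k - a\<bar>) sequentially"
      using eventually_gt_at_top[of 0]
    proof eventually_elim
      case (elim k)
      have "\<bar>1 + a / real k\<bar> \<le> 1"
        using elim \<open>a \<le> 0\<close> by (simp add: abs_le_iff field_simps)
      then have "norm ((1 + x k / real k) ^ k - (1 + a / real k) ^ k)
          \<le> real k * norm ((1 + x k / real k) - (1 + a / real k))"
        using le1[of k] by (intro norm_power_diff) auto
      also have "\<dots> = \<bar>x k - a\<bar>"
        using elim by (simp add: abs_mult flip: diff_divide_distrib)
      finally show ?case .
    qed
  qed
qed

lemma scaled_cos_tendsto:
  "(\<lambda>k. real k * (cos (b / sqrt (real k)) - 1)) \<longlonglongrightarrow> - (b\<^sup>2 / 2)"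
proof (cases "b = 0")
  case False
  have lim: "((\<lambda>y::real. (cos y - 1) / y\<^sup>2) \<longlongrightarrow> - (1/2)) (at 0)"
    by real_asymp
  have "(\<lambda>k. b * (1 / sqrt (real k))) \<longlonglongrightarrow> b * 0"
    by (intro tendsto_mult_left) real_asymp
  then have "filterlim (\<lambda>k. b / sqrt (real k)) (at 0) sequentially"
    using False eventually_gt_at_top[of "0::nat"]
    by (auto simp: filterlim_at elim!: eventually_mono)
  from tendsto_mult_left[OF filterlim_compose[OF lim this], of "b\<^sup>2"]
  have "(\<lambda>k. b\<^sup>2 * ((cos (b / sqrt (real k)) - 1) / (b / sqrt (real k))\<^sup>2)) \<longlonglongrightarrow> - (b\<^sup>2 / 2)"
    by simp
  then show ?thesis
    by (rule Lim_transform_eventually)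
       (use False in \<open>auto simp: power_divide intro!: eventually_mono[OF eventually_gt_at_top[of 0]]\<close>)
qed simp

lemma abs_uniform_char_le_1: "\<bar>uniform_char l t\<bar> \<le> 1"
proof -
  have "\<bar>\<Sum>j\<le>l. cos ((real j - real l / 2) * t)\<bar> \<le> real (card {..l}) * 1"
    using sum_norm_bound[of "{..l}" "\<lambda>j. cos ((real j - real l / 2) * t)" 1] by simp
  then show ?thesis
    by (simp add: uniform_char_def abs_divide add.commute)
qed

lemma uniform_char_power_tendsto:
  "(\<lambda>k. uniform_char l (s / sqrt (real k)) ^ k)
     \<longlonglongrightarrow> exp (- (((real l + 1)\<^sup>2 - 1) / 12 * s\<^sup>2 / 2))"
proof -
  define x where "x k = real k * (uniform_char l (s / sqrt (real k)) - 1)" for k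
  have x_eq: "x k = (\<Sum>j\<le>l. real k * (cos ((real j - real l / 2) * s / sqrt (real k)) - 1)) / (real l + 1)" for k
    unfolding x_def uniform_char_def
    by (simp add: sum_subtractf field_simps flip: sum_distrib_left)
  have "x \<longlonglongrightarrow> (\<Sum>j\<le>l. - (((real j - real l / 2) * s)\<^sup>2 / 2)) / (real l + 1)"
    unfolding x_eq by (intro tendsto_divide tendsto_sum scaled_cos_tendsto tendsto_const) simp
  also have "(\<Sum>j\<le>l. - (((real j - real l / 2) * s)\<^sup>2 / 2))
      = (\<Sum>j\<le>l. (real j - real l / 2)\<^sup>2) * (- (s\<^sup>2 / 2))"
    by (simp add: sum_distrib_right power_mult_distrib sum_negf)
  also have "\<dots> / (real l + 1) = - (((real l + 1)\<^sup>2 - 1) / 12 * s\<^sup>2 / 2)"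
    unfolding sum_centred_squares by (simp add: divide_simps)
  finally have lim: "x \<longlonglongrightarrow> - (((real l + 1)\<^sup>2 - 1) / 12 * s\<^sup>2 / 2)" .
  \<comment> \<open>the case \<open>k = 0\<close> is separate because division by 0 gives 0\<close>
  have eq: "1 + x k / real k = (if k = 0 then 1 else uniform_char l (s / sqrt (real k)))" for k
    by (simp add: x_def)
  have "(\<lambda>k. (1 + x k / real k) ^ k) \<longlonglongrightarrow> exp (- (((real l + 1)\<^sup>2 - 1) / 12 * s\<^sup>2 / 2))"
    using lim by (rule power_one_plus_tendsto_exp) (auto simp: eq abs_uniform_char_le_1)
  then show ?thesis
    by (rule Lim_transform_eventually) (auto simp: eq intro!: eventually_mono[OF eventually_gt_at_top[of 0]])
qed

section \<open>The limit of the rescaled integral\<close>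

lemma gaussian_integral:
  fixes v :: real
  assumes "v > 0"
  shows "has_bochner_integral lborel (\<lambda>s. exp (- (v * s\<^sup>2 / 2))) (sqrt (2 * pi / v))"
proof -
  have "has_bochner_integral lborel (\<lambda>s. sqrt (2 * pi / v) * normal_density 0 (1 / sqrt v) s) (sqrt (2 * pi / v) * 1)"
    using assms by (intro has_bochner_integral_mult_right) (simp add: has_bochner_integral_iff)
  moreover have "sqrt (2 * pi / v) * normal_density 0 (1 / sqrt v) s = exp (- (v * s\<^sup>2 / 2))" for s
    using assms by (simp add: normal_density_def power_divide mult.commute)
  ultimately show ?thesis by simp
qed

lemma rescaled_integral_tendsto:
  fixes d :: "nat \<Rightarrow> real"
  assumes "l \<ge> 1" and "\<And>k. \<bar>d k\<bar> \<le> 1"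
  defines "v \<equiv> ((real l + 1)\<^sup>2 - 1) / 12"
  shows "(\<lambda>k. sqrt (real k) * (\<integral>t. uniform_char l t ^ k * cos (d k * t) * indicator {-pi..pi} t \<partial>lborel))
           \<longlonglongrightarrow> sqrt (2 * pi / v)"
proof -
  \<comment> \<open>chosen so that \<open>c s^2 / 2\<close> is the exponent \<open>s^2 / (16 (l + 1))\<close> of \<open>abs_uniform_char_le\<close>\<close>
  define c where "c = 1 / (8 * (real l + 1))"
  have "c > 0" by (simp add: c_def)
  have "v > 0"
    using assms(1) by (simp add: v_def power2_eq_square algebra_simps add_pos_pos)
  define f where "f k s = uniform_char l (s / sqrt (real k)) ^ k * cos (d k * (s / sqrt (real k)))
      * indicator {-pi..pi} (s / sqrt (real k))" for k s
  have scale: "sqrt (real k) * (\<integral>t. uniform_char l t ^ k * cos (d k * t) * indicator {-pi..pi} t \<partial>lborel)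
      = (\<integral>s. f k s \<partial>lborel)" if "k > 0" for k
    using that lborel_integral_real_affine[of "1 / sqrt (real k)"
        "\<lambda>t. uniform_char l t ^ k * cos (d k * t) * indicator {-pi..pi} t" 0]
    by (simp add: f_def)
  \<comment> \<open>shifted to \<open>Suc k\<close>: the majorant must hold for every index, and it fails at \<open>k = 0\<close>\<close>
  have "(\<lambda>k. \<integral>s. f (Suc k) s \<partial>lborel) \<longlonglongrightarrow> (\<integral>s. exp (- (v * s\<^sup>2 / 2)) \<partial>lborel)"
  proof (rule integral_dominated_convergence)
    show "integrable lborel (\<lambda>s. exp (- (c * s\<^sup>2 / 2)))"
      using gaussian_integral[OF \<open>c > 0\<close>] by (simp add: has_bochner_integral_iff)
    show "AE s in lborel. (\<lambda>k. f (Suc k) s) \<longlonglongrightarrow> exp (- (v * s\<^sup>2 / 2))"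
    proof (rule AE_I2)
      fix s :: real
      have s0: "(\<lambda>k. s / sqrt (real k)) \<longlonglongrightarrow> 0"
        using tendsto_mult_left[of "\<lambda>k. 1 / sqrt (real k)" 0 sequentially s] by (simp, real_asymp)
      have "(\<lambda>k. d k * (s / sqrt (real k))) \<longlonglongrightarrow> 0"
      proof (rule Lim_null_comparison[OF _ tendsto_rabs_zero[OF s0]])
        show "\<forall>\<^sub>F k in sequentially. norm (d k * (s / sqrt (real k))) \<le> \<bar>s / sqrt (real k)\<bar>"
          using assms(2) by (intro always_eventually allI) (simp only: real_norm_def abs_mult, rule mult_left_le_one_le, auto)
      qed
      then have cos1: "(\<lambda>k. cos (d k * (s / sqrt (real k)))) \<longlonglongrightarrow> 1"
        using tendsto_cos by fastforce
      have "\<forall>\<^sub>F k in sequentially. \<bar>s / sqrt (real k)\<bar> < pi"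
        using tendsto_rabs_zero[OF s0] pi_gt_zero by (rule order_tendstoD)
      then have "(\<lambda>k. indicator {-pi..pi} (s / sqrt (real k)) :: real) \<longlonglongrightarrow> 1"
        by (intro tendsto_eventually) (auto elim!: eventually_mono simp: indicator_def abs_less_iff simp del: abs_divide)
      from tendsto_mult[OF tendsto_mult[OF uniform_char_power_tendsto[of l s] cos1] this]
      have "(\<lambda>k. f k s) \<longlonglongrightarrow> exp (- (v * s\<^sup>2 / 2))"
        by (simp add: f_def v_def)
      then show "(\<lambda>k. f (Suc k) s) \<longlonglongrightarrow> exp (- (v * s\<^sup>2 / 2))"
        by (rule LIMSEQ_Suc)
    qed
    show "AE s in lborel. norm (f (Suc k) s) \<le> exp (- (c * s\<^sup>2 / 2))" for k
    proof (rule AE_I2)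
      fix s :: real
      define t where "t = s / sqrt (real (Suc k))"
      show "norm (f (Suc k) s) \<le> exp (- (c * s\<^sup>2 / 2))"
      proof (cases "\<bar>t\<bar> \<le> pi")
        case True
        have "norm (f (Suc k) s) \<le> \<bar>uniform_char l t\<bar> ^ Suc k * 1 * 1"
          unfolding f_def t_def[symmetric] real_norm_def abs_mult power_abs
          by (intro mult_mono order.refl) auto
        also have "\<dots> \<le> exp (- (t\<^sup>2 / (16 * (real l + 1)))) ^ Suc k"
          using abs_uniform_char_le[OF assms(1) True] by (simp only: mult_1_right) (rule power_mono, auto)
        also have "\<dots> = exp (- (real (Suc k) * t\<^sup>2 / (16 * (real l + 1))))"
          by (simp only: exp_of_nat_mult[symmetric]) simp
        also have "real (Suc k) * t\<^sup>2 = s\<^sup>2"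
          by (simp add: t_def power_divide del: of_nat_Suc)
        finally show ?thesis by (simp add: c_def)
      next
        case False
        then have "t \<notin> {-pi..pi}" by auto
        then show ?thesis by (simp add: f_def t_def)
      qed
    qed
  qed (auto simp: f_def)
  also have "(\<integral>s. exp (- (v * s\<^sup>2 / 2)) \<partial>lborel) = sqrt (2 * pi / v)"
    using gaussian_integral[OF \<open>v > 0\<close>] by (simp add: has_bochner_integral_iff)
  finally have "(\<lambda>k. \<integral>s. f k s \<partial>lborel) \<longlonglongrightarrow> sqrt (2 * pi / v)"
    by (rule LIMSEQ_imp_Suc)
  then show ?thesis
    by (rule Lim_transform_eventually)
       (auto simp: scale intro!: eventually_mono[OF eventually_gt_at_top[of 0]])
qed

theorem mainTheorem1:
  fixes l :: nat
  assumes "l \<ge> 1"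
  shows "(\<lambda>k::nat. real (ext_binomial (l + 1) k (nat \<lfloor>real (k * l) / 2\<rfloor>)) /
           ((real l + 1) ^ k / sqrt (2 * pi * real k * (((real l + 1)\<^sup>2 - 1) / 12))))
         \<longlonglongrightarrow> 1"
proof -
  define v where "v = ((real l + 1)\<^sup>2 - 1) / 12"
  have "v > 0"
    using assms by (simp add: v_def power2_eq_square algebra_simps add_pos_pos)
  define n where "n k = nat \<lfloor>real (k * l) / 2\<rfloor>" for k
  define d where "d k = real (k * l) / 2 - real (n k)" for k
  define J where "J k = (\<integral>t. uniform_char l t ^ k * cos (d k * t) * indicator {-pi..pi} t \<partial>lborel)" for k
  have n_eq: "real (n k) = of_int \<lfloor>real (k * l) / 2\<rfloor>" for k
    unfolding n_def by (rule of_nat_nat) (simp add: zero_le_floor)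
  have "\<bar>d k\<bar> \<le> 1" for k
    unfolding d_def n_eq by linarith
  from rescaled_integral_tendsto[OF assms this]
  have "(\<lambda>k. sqrt (real k) * J k) \<longlonglongrightarrow> sqrt (2 * pi / v)"
    by (simp add: J_def v_def)
  then have "(\<lambda>k. sqrt (2 * pi * v) / (2 * pi) * (sqrt (real k) * J k))
      \<longlonglongrightarrow> sqrt (2 * pi * v) / (2 * pi) * sqrt (2 * pi / v)"
    by (rule tendsto_mult_left)
  also have "sqrt (2 * pi * v) / (2 * pi) * sqrt (2 * pi / v) = 1"
  proof -
    have "sqrt (2 * pi * v) * sqrt (2 * pi / v) = sqrt ((2 * pi)\<^sup>2)"
      using \<open>v > 0\<close> by (subst real_sqrt_mult[symmetric]) (simp add: power2_eq_square)
    also have "\<dots> = 2 * pi" by (rule real_sqrt_unique) auto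
    finally show ?thesis by simp
  qed
  also have "(\<lambda>k. sqrt (2 * pi * v) / (2 * pi) * (sqrt (real k) * J k))
     = (\<lambda>k. real (ext_binomial (l + 1) k (n k)) / ((real l + 1) ^ k / sqrt (2 * pi * real k * v)))"
  proof
    fix k
    have "real (n k) \<le> real (k * l)"
      unfolding n_eq by linarith
    then have "n k \<le> k * l" by (simp only: of_nat_le_iff)
    then have "2 * pi * real (ext_binomial (Suc l) k (n k)) = (real l + 1) ^ k * J k"
      unfolding J_def d_def by (rule ext_binomial_integral)
    then have "real (ext_binomial (Suc l) k (n k)) = (real l + 1) ^ k * J k / (2 * pi)"
      by (simp add: field_simps)
    moreover have "(real l + 1) ^ k \<noteq> 0" by simp
    ultimately show "sqrt (2 * pi * v) / (2 * pi) * (sqrt (real k) * J k)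
        = real (ext_binomial (l + 1) k (n k)) / ((real l + 1) ^ k / sqrt (2 * pi * real k * v))"
      by (simp add: real_sqrt_mult)
  qed
  finally show ?thesis by (simp only: n_def v_def)
qed

end
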